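(* Let $\pi$ and $\sigma$ be permutations such that $\pi\le\sigma$ ($\pi$ is a pattern of $\sigma$). Then $\mathcal{L}_\sigma\subseteq\mathcal{L}_\pi$.
   Context: Pattern: $\pi$ of size $k$ is a pattern of $\sigma$ if some subsequence $\sigma_{i_1}\cdots\sigma_{i_k}$, $i_1<\dots<i_k$, is order-isomorphic to $\pi$. Pin words: a pin representation of a permutation is a sequence of points $(p_1,\dots,p_n)$, no two on a common horizontal or vertical line, order-isomorphic to the permutation's diagram $\{(i,\pi_i)\}$, where each $p_i$ ($i\ge2$) lies outside the bounding box (smallest axis-parallel rectangle) of $\{p_1,\dots,p_{i-1}\}$ and either separates $p_{i-1}$ from $\{p_1,\dots,p_{i-2}\}$ (the horizontal or vertical line through $p_i$ has them on opposite sides) or separates no two nonempty subsets of $\{p_1,\dots,p_{i-1}\}$. Choosing an origin $p_0$ such that $(p_0,\dots,p_n)$ satisfies the same conditions, encode $p_i$ ($i\ge1$) by $U/D/L/R$ if $p_i$ separates $p_{i-1}$ from $\{p_0,\dots,p_{i-2}\}$ from the top/bottom/left/right, and by $1/2/3/4$ if $p_i$ separates no two nonempty subsets of $\{p_0,\dots,p_{i-1}\}$ and lies up-right/up-left/bottom-left/bottom-right of their bounding box. $P(\pi)$ is the set of all words so obtained for $\pi$ (pin words; empty if $\pi$ has no pin representation). A strict pin word is a numeral followed only by directions ($U,D,L,R$). Cutting a pin word $u$ before each numeral gives its strong numeral-led factor decomposition $u=u^{(1)}\cdots u^{(j)}$. With $A=\{U,D,L,R\}$, $\phi$ maps a strict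 pin word $u=u'u''$, $|u'|=2$, to $\varphi(u')u''$ with $\varphi$: $1R\mapsto RUR$, $1L\mapsto RUL$, $1U\mapsto URU$, $1D\mapsto URD$, $2R\mapsto LUR$, $2L\mapsto LUL$, $2U\mapsto ULU$, $2D\mapsto ULD$, $3R\mapsto LDR$, $3L\mapsto LDL$, $3U\mapsto DLU$, $3D\mapsto DLD$, $4R\mapsto RDR$, $4L\mapsto RDL$, $4U\mapsto DRU$, $4D\mapsto DRD$, and maps single numerals to sets: $\phi(1)=\{UR,RU\}$, $\phi(2)=\{UL,LU\}$, $\phi(3)=\{DL,LD\}$, $\phi(4)=\{RD,DR\}$. Then $\mathcal{L}(u)=A^\star\phi(u^{(1)})A^\star\cdots A^\star\phi(u^{(j)})A^\star$ and $\mathcal{L}_\pi=\bigcup_{u\in P(\pi)}\mathcal{L}(u)$. *)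

theory Defs
  imports Complex_Main "HOL-Library.Sublist" "HOL-Combinatorics.Multiset_Permutations"
begin

text \<open>Permutations of size \<open>n\<close> are written in one-line notation, as members of
  \<^term>\<open>permutations_of_set {1..n} :: nat list set\<close>.\<close>

definition order_isomorphic :: "nat list \<Rightarrow> nat list \<Rightarrow> bool" where
  "order_isomorphic xs ys \<longleftrightarrow> length xs = length ys \<and>
     (\<forall>i<length xs. \<forall>j<length xs. xs ! i < xs ! j \<longleftrightarrow> ys ! i < ys ! j)"

definition pattern_of :: "nat list \<Rightarrow> nat list \<Rightarrow> bool" where
  "pattern_of \<pi> \<sigma> \<longleftrightarrow> (\<exists>\<tau>. subseq \<tau> \<sigma> \<and> order_isomorphic \<tau> \<pi>)"

type_synonym point = "real \<times> real"

definition diagram :: "nat list \<Rightarrow> point set" where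
  "diagram \<pi> = {(real (Suc i), real (\<pi> ! i)) | i. i < length \<pi>}"

definition order_isomorphic_points :: "point set \<Rightarrow> point set \<Rightarrow> bool" where
  "order_isomorphic_points S T \<longleftrightarrow> (\<exists>f. bij_betw f S T \<and>
     (\<forall>p\<in>S. \<forall>q\<in>S. (fst p < fst q \<longleftrightarrow> fst (f p) < fst (f q)) \<and>
                  (snd p < snd q \<longleftrightarrow> snd (f p) < snd (f q))))"

text \<open>Only used for finite nonempty \<open>S\<close>.\<close>

definition bounding_box :: "point set \<Rightarrow> point set" where
  "bounding_box S = {Min (fst ` S)..Max (fst ` S)} \<times> {Min (snd ` S)..Max (snd ` S)}"

definition opposite_sides :: "real \<Rightarrow> real set \<Rightarrow> real set \<Rightarrow> bool" where
  "opposite_sides c X Y \<longleftrightarrow>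
     (\<forall>x\<in>X. x < c) \<and> (\<forall>y\<in>Y. c < y) \<or> (\<forall>x\<in>X. c < x) \<and> (\<forall>y\<in>Y. y < c)"

text \<open>The vertical (first disjunct) or horizontal (second disjunct) line through \<open>p\<close> has
  \<open>A\<close> and \<open>B\<close> on opposite sides. Both sets are required to be nonempty, so that
  separating something from the empty set never holds vacuously.\<close>

definition separates :: "point \<Rightarrow> point set \<Rightarrow> point set \<Rightarrow> bool" where
  "separates p A B \<longleftrightarrow> A \<noteq> {} \<and> B \<noteq> {} \<and>
     (opposite_sides (fst p) (fst ` A) (fst ` B) \<or> opposite_sides (snd p) (snd ` A) (snd ` B))"

definition separates_nothing :: "point \<Rightarrow> point set \<Rightarrow> bool" where
  "separates_nothing p S \<longleftrightarrow> \<not> (\<exists>A B. A \<subseteq> S \<and> B \<subseteq> S \<and> separates p A B)"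

text \<open>Point \<open>ps ! i\<close> is preceded by \<open>take i ps\<close>, whose last entry is \<open>ps ! (i - 1)\<close>.\<close>

definition pin_sequence :: "point list \<Rightarrow> bool" where
  "pin_sequence ps \<longleftrightarrow>
     (\<forall>i<length ps. \<forall>j<length ps. i \<noteq> j \<longrightarrow>
        fst (ps ! i) \<noteq> fst (ps ! j) \<and> snd (ps ! i) \<noteq> snd (ps ! j)) \<and>
     (\<forall>i. 1 \<le> i \<and> i < length ps \<longrightarrow>
        ps ! i \<notin> bounding_box (set (take i ps)) \<and>
        (separates (ps ! i) {ps ! (i - 1)} (set (take (i - 1) ps)) \<or>
         separates_nothing (ps ! i) (set (take i ps))))"

definition pin_representation :: "point list \<Rightarrow> nat list \<Rightarrow> bool" where
  "pin_representation ps \<pi> \<longleftrightarrow>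
     pin_sequence ps \<and> order_isomorphic_points (set ps) (diagram \<pi>)"

datatype letter = One | Two | Three | Four | U | D | L | R

definition directions :: "letter set" where
  "directions = {U, D, L, R}"

definition above :: "point \<Rightarrow> point set \<Rightarrow> bool" where
  "above p S \<longleftrightarrow> (\<forall>q\<in>S. snd q < snd p)"

definition below :: "point \<Rightarrow> point set \<Rightarrow> bool" where
  "below p S \<longleftrightarrow> (\<forall>q\<in>S. snd p < snd q)"

definition left_of :: "point \<Rightarrow> point set \<Rightarrow> bool" where
  "left_of p S \<longleftrightarrow> (\<forall>q\<in>S. fst p < fst q)"

definition right_of :: "point \<Rightarrow> point set \<Rightarrow> bool" where
  "right_of p S \<longleftrightarrow> (\<forall>q\<in>S. fst q < fst p)"

fun on_side :: "letter \<Rightarrow> point \<Rightarrow> point set \<Rightarrow> bool" where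
  "on_side U p S \<longleftrightarrow> above p S"
| "on_side D p S \<longleftrightarrow> below p S"
| "on_side L p S \<longleftrightarrow> left_of p S"
| "on_side R p S \<longleftrightarrow> right_of p S"
| "on_side One p S \<longleftrightarrow> above p S \<and> right_of p S"
| "on_side Two p S \<longleftrightarrow> above p S \<and> left_of p S"
| "on_side Three p S \<longleftrightarrow> below p S \<and> left_of p S"
| "on_side Four p S \<longleftrightarrow> below p S \<and> right_of p S"

text \<open>\<open>encodes qs p x\<close>: the pin \<open>p\<close> following \<open>qs = [p\<^sub>0, \<dots>, p\<^bsub>i-1\<^esub>]\<close> is encoded by \<open>x\<close>.
  For \<open>qs = [p\<^sub>0]\<close> only numerals are possible.\<close>

definition encodes :: "point list \<Rightarrow> point \<Rightarrow> letter \<Rightarrow> bool" where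
  "encodes qs p x \<longleftrightarrow> on_side x p (bounding_box (set qs)) \<and>
     (if x \<in> directions then separates p {last qs} (set (butlast qs))
      else separates_nothing p (set qs))"

definition pin_words :: "nat list \<Rightarrow> letter list set" where
  "pin_words \<pi> = {u. \<exists>p0 ps. pin_representation ps \<pi> \<and> pin_sequence (p0 # ps) \<and>
     length u = length ps \<and>
     (\<forall>i<length ps. encodes (p0 # take i ps) (ps ! i) (u ! i))}"

lemma length_dropWhile_less [termination_simp]: "length (dropWhile P u) < Suc (length u)"
  by (simp add: length_dropWhile_le less_Suc_eq_le)

fun numeral_led_factors :: "letter list \<Rightarrow> letter list list" where
  "numeral_led_factors [] = []"
| "numeral_led_factors (x # u) =
     (x # takeWhile (\<lambda>y. y \<in> directions) u) #
       numeral_led_factors (dropWhile (\<lambda>y. y \<in> directions) u)"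

text \<open>The tables are specified on the relevant arguments only: every factor of a pin word is
  a numeral followed by directions.\<close>

fun phi_numeral :: "letter \<Rightarrow> letter list set" where
  "phi_numeral One = {[U, R], [R, U]}"
| "phi_numeral Two = {[U, L], [L, U]}"
| "phi_numeral Three = {[D, L], [L, D]}"
| "phi_numeral Four = {[R, D], [D, R]}"

fun varphi :: "letter \<Rightarrow> letter \<Rightarrow> letter list" where
  "varphi One R = [R, U, R]"
| "varphi One L = [R, U, L]"
| "varphi One U = [U, R, U]"
| "varphi One D = [U, R, D]"
| "varphi Two R = [L, U, R]"
| "varphi Two L = [L, U, L]"
| "varphi Two U = [U, L, U]"
| "varphi Two D = [U, L, D]"
| "varphi Three R = [L, D, R]"
| "varphi Three L = [L, D, L]"
| "varphi Three U = [D, L, U]"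
| "varphi Three D = [D, L, D]"
| "varphi Four R = [R, D, R]"
| "varphi Four L = [R, D, L]"
| "varphi Four U = [D, R, U]"
| "varphi Four D = [D, R, D]"

fun phi :: "letter list \<Rightarrow> letter list set" where
  "phi [] = {}"
| "phi [x] = phi_numeral x"
| "phi (x # y # u) = {varphi x y @ u}"

fun factors_language :: "letter list list \<Rightarrow> letter list set" where
  "factors_language [] = lists directions"
| "factors_language (f # fs) =
     {a @ b @ c | a b c. a \<in> lists directions \<and> b \<in> phi f \<and> c \<in> factors_language fs}"

definition word_language :: "letter list \<Rightarrow> letter list set" where
  "word_language u = factors_language (numeral_led_factors u)"

definition perm_language :: "nat list \<Rightarrow> letter list set" where
  "perm_language \<pi> = (\<Union>u\<in>pin_words \<pi>. word_language u)"

end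

theory Submission
  imports Defs
begin

text \<open>Delete the points of \<open>\<sigma>\<close> outside the pattern one at a time, keeping the origin. If the pin
  following the deleted one is encoded by a direction, it no longer separates anything and becomes
  a numeral; all other letters are unchanged. The table \<open>\<phi>\<close> is such that the language of the new
  word contains that of the old one: deleting \<open>X\<close> from a factor \<open>\<dots> X Y \<dots>\<close>, the word
  \<open>X Y\<close> remains available as an image under \<open>\<phi>\<close> of the numeral that replaces \<open>Y\<close>.\<close>

subsection \<open>Words and languages\<close>

definition perpendicular :: "letter \<Rightarrow> letter \<Rightarrow> bool" where
  "perpendicular x y \<longleftrightarrow> x \<in> {U, D} \<and> y \<in> {L, R} \<or> x \<in> {L, R} \<and> y \<in> {U, D}"

text \<open>The numeral of the quadrant lying towards both \<open>x\<close> and \<open>y\<close>.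
  Arguments that are not perpendicular fall through to \<open>Four\<close>, so the value is a
  numeral in every case.\<close>

definition corner :: "letter \<Rightarrow> letter \<Rightarrow> letter" where
  "corner x y = (if {x, y} = {U, R} then One else if {x, y} = {U, L} then Two
     else if {x, y} = {D, L} then Three else Four)"

text \<open>Says that a factor boundary may precede \<open>u\<close>; the empty word counts, so that
  a suffix may also be exhausted.\<close>

definition numeral_led :: "letter list \<Rightarrow> bool" where
  "numeral_led u \<longleftrightarrow> u = [] \<or> hd u \<notin> directions"

section \<open>Concatenation of languages and factor decompositions\<close>

definition conc :: "'a list set \<Rightarrow> 'a list set \<Rightarrow> 'a list set" (infixr "\<cdot>" 75) where
  "A \<cdot> B = {a @ b | a b. a \<in> A \<and> b \<in> B}"

lemma conc_mono: "A \<subseteq> A' \<Longrightarrow> B \<subseteq> B' \<Longrightarrow> A \<cdot> B \<subseteq> A' \<cdot> B'"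
  by (auto simp: conc_def)

lemma conc_assoc: "(A \<cdot> B) \<cdot> C = A \<cdot> (B \<cdot> C)"
proof (intro equalityI subsetI)
  fix x assume "x \<in> (A \<cdot> B) \<cdot> C"
  then obtain a b c where "x = (a @ b) @ c" "a \<in> A" "b \<in> B" "c \<in> C"
    unfolding conc_def by blast
  then show "x \<in> A \<cdot> (B \<cdot> C)"
    unfolding conc_def append_assoc by blast
next
  fix x assume "x \<in> A \<cdot> (B \<cdot> C)"
  then obtain a b c where "x = a @ (b @ c)" "a \<in> A" "b \<in> B" "c \<in> C"
    unfolding conc_def by blast
  then show "x \<in> (A \<cdot> B) \<cdot> C"
    unfolding conc_def append_assoc[symmetric] by blast
qed

lemma lists_conc_lists: "lists A \<cdot> lists A = lists A"
proof
  have "lists A = {[]} \<cdot> lists A"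
    by (auto simp: conc_def)
  then show "lists A \<subseteq> lists A \<cdot> lists A"
    by (metis conc_mono empty_subsetI insert_subset lists.Nil order_refl)
qed (auto simp: conc_def)

lemma lists_conc_lists_left: "lists A \<cdot> lists A \<cdot> B = lists A \<cdot> B"
  by (simp add: lists_conc_lists flip: conc_assoc)

lemma factors_language_Cons:
  "factors_language (f # fs) = lists directions \<cdot> phi f \<cdot> factors_language fs"
  by (auto simp: conc_def)

lemma lists_conc_factors_language:
  "lists directions \<cdot> factors_language fs = factors_language fs"
  by (cases fs)
     (simp_all add: factors_language_Cons lists_conc_lists conc_assoc[symmetric]
       del: factors_language.simps(2))

text \<open>The \<open>lists directions\<close> closing the left language and the one opening the
  right language meet at the seam and merge into one.\<close>

lemma factors_language_append:
  "factors_language (fs @ gs) = factors_language fs \<cdot> factors_language gs"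
  by (induction fs)
     (simp_all add: factors_language_Cons lists_conc_factors_language conc_assoc
       del: factors_language.simps(2))

text \<open>Cuts occur only before numerals. Leading directions of \<open>v\<close> would be
  swallowed by the last factor of \<open>u\<close>, hence the hypothesis.\<close>

lemma numeral_led_factors_append:
  "numeral_led v \<Longrightarrow> numeral_led_factors (u @ v) = numeral_led_factors u @ numeral_led_factors v"
proof (induction u rule: numeral_led_factors.induct)
  case (2 x u)
  have "takeWhile (\<lambda>y. y \<in> directions) (u @ v) = takeWhile (\<lambda>y. y \<in> directions) u"
    using 2(2) by (induction u) (cases v; simp add: numeral_led_def)+
  moreover have "dropWhile (\<lambda>y. y \<in> directions) (u @ v) = dropWhile (\<lambda>y. y \<in> directions) u @ v"
    using 2(2) by (induction u) (cases v; simp add: numeral_led_def)+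
  ultimately show ?case
    using 2 by simp
qed simp

lemma word_language_append:
  "numeral_led v \<Longrightarrow> word_language (u @ v) = word_language u \<cdot> word_language v"
  by (simp add: word_language_def numeral_led_factors_append factors_language_append)

lemma word_language_factor:
  assumes "d \<in> lists directions"
  shows "word_language (n # d) = lists directions \<cdot> phi (n # d) \<cdot> lists directions"
proof -
  have *: "takeWhile (\<lambda>y. y \<in> directions) d = d" "dropWhile (\<lambda>y. y \<in> directions) d = []"
    using assms by auto
  show ?thesis
    by (simp add: * word_language_def factors_language_Cons del: factors_language.simps(2))
qed

lemma lists_conc_word_language: "lists directions \<cdot> word_language u = word_language u"
  by (simp add: word_language_def lists_conc_factors_language)

text \<open>The pattern behind the table: spell the numeral by its two directions, in the order that
  makes the second one perpendicular to \<open>y\<close>, then append \<open>y\<close>.\<close>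

lemma varphi_split:
  assumes "x \<notin> directions" "y \<in> directions"
  obtains a b where "varphi x y = [a, b, y]" "[a, b] \<in> phi_numeral x" "perpendicular b y"
    "a \<in> directions"
  using assms by (cases x; cases y; force simp: directions_def perpendicular_def)

text \<open>Only an inclusion: when \<open>d\<close> is empty and \<open>e\<close> is not, the first
  letter of \<open>e\<close> selects one of the two spellings of the numeral
  \<open>n\<close>.\<close>

lemma phi_append:
  assumes "n \<notin> directions" "e \<in> lists directions"
  shows "phi (n # d @ e) \<subseteq> phi (n # d) \<cdot> {e}"
proof (cases d)
  case Nil
  show ?thesis
  proof (cases e)
    case (Cons x e')
    then show ?thesis
      using Nil assms varphi_split[of n x] by (fastforce simp: conc_def)
  qed (simp add: Nil conc_def)
qed (simp add: conc_def)

text \<open>A lone numeral admits both spellings. If a direction follows, the table ends the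
  spelling with the letter perpendicular to it, which by hypothesis is \<open>y\<close>.\<close>

lemma corner_phi:
  assumes "perpendicular x y" "t = [] \<or> perpendicular y (hd t)"
  shows "x # y # t \<in> phi (corner x y # t)"
proof (cases t)
  case Nil
  then show ?thesis
    using assms by (auto simp: perpendicular_def corner_def doubleton_eq_iff)
next
  case (Cons z t')
  then show ?thesis
    using assms by (auto simp: perpendicular_def corner_def doubleton_eq_iff)
qed

lemma corner_not_direction: "corner x y \<notin> directions"
  by (simp add: corner_def directions_def)

lemma phi_subset_lists:
  "x \<notin> directions \<Longrightarrow> d \<in> lists directions \<Longrightarrow> phi (x # d) \<subseteq> lists directions"
  by (cases d; cases x; cases "hd d") (auto simp: directions_def)

section \<open>Language inclusions when a letter is deleted\<close>

lemma numeral_led_cases: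
  assumes "numeral_led u" "u \<noteq> []"
  obtains v n d where "u = v @ n # d" "n \<notin> directions" "d \<in> lists directions" "numeral_led v"
proof -
  have "\<exists>x \<in> set u. x \<notin> directions"
    using assms by (auto simp: numeral_led_def intro: bexI[of _ "hd u"])
  then obtain v n d where "u = v @ n # d" "n \<notin> directions" "\<forall>x\<in>set d. x \<in> directions"
    using split_list_last_prop[of u "\<lambda>x. x \<notin> directions"] by blast
  then show ?thesis
    using that[of v n d] assms by (cases v) (auto simp: numeral_led_def)
qed

lemma direction_split:
  obtains t v where "u = t @ v" "t \<in> lists directions" "numeral_led v"
    "t = [] \<or> hd u = hd t \<and> u \<noteq> [] \<and> hd u \<in> directions"
proof
  let ?t = "takeWhile (\<lambda>y. y \<in> directions) u" and ?v = "dropWhile (\<lambda>y. y \<in> directions) u"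
  show "u = ?t @ ?v" by simp
  show "?t \<in> lists directions" by (auto dest: set_takeWhileD)
  show "numeral_led ?v" using hd_dropWhile[of "\<lambda>y. y \<in> directions" u] by (auto simp: numeral_led_def)
  show "?t = [] \<or> hd u = hd ?t \<and> u \<noteq> [] \<and> hd u \<in> directions" by (cases u) auto
qed

text \<open>Whatever \<open>x\<close> contributes consists of directions and is absorbed by a
  neighbouring \<open>lists directions\<close>: a numeral as a factor of its own, a direction as the
  end of the last factor of \<open>u\<close>. The third hypothesis excludes a direction with no
  factor to belong to.\<close>

lemma word_language_drop_letter:
  assumes u: "numeral_led u" and v: "numeral_led v" and "numeral_led (u @ [x])"
  shows "word_language (u @ x # v) \<subseteq> word_language (u @ v)"
proof (cases "x \<in> directions")
  case False
  then have xv: "numeral_led (x # v)" "numeral_led [x]"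
    by (auto simp: numeral_led_def)
  have "phi [x] \<subseteq> lists directions"
    using False by (intro phi_subset_lists) auto
  then have "word_language [x] \<subseteq> lists directions"
    unfolding word_language_factor[OF lists.Nil]
    by (metis conc_mono lists_conc_lists order_refl)
  then have "word_language [x] \<cdot> word_language v \<subseteq> word_language v"
    by (metis conc_mono lists_conc_word_language order_refl)
  moreover have "word_language (x # v) = word_language [x] \<cdot> word_language v"
    using word_language_append[OF v, of "[x]"] by simp
  ultimately show ?thesis
    using v xv by (simp add: word_language_append conc_mono)
next
  case True
  then have "u \<noteq> []"
    using assms(3) by (auto simp: numeral_led_def)
  with u obtain w n d where w: "u = w @ n # d" "n \<notin> directions" "d \<in> lists directions"
    by (rule numeral_led_cases)
  have "phi (n # d @ [x]) \<subseteq> phi (n # d) \<cdot> {[x]}"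
    using w True by (intro phi_append) auto
  also have "\<dots> \<subseteq> phi (n # d) \<cdot> lists directions"
    using True by (intro conc_mono) auto
  finally have "word_language (n # d @ [x]) \<subseteq>
      lists directions \<cdot> (phi (n # d) \<cdot> lists directions) \<cdot> lists directions"
    using w(3) True by (subst word_language_factor) (simp, intro conc_mono order_refl, simp_all)
  also have "\<dots> = word_language (n # d)"
    using w by (simp add: word_language_factor conc_assoc lists_conc_lists)
  finally have "word_language (n # d @ [x]) \<subseteq> word_language (n # d)" .
  moreover have "u @ x # v = w @ (n # d @ [x]) @ v" "u @ v = w @ (n # d) @ v"
    using w by auto
  moreover have "numeral_led ((n # d @ [x]) @ v)" "numeral_led ((n # d) @ v)"
    using w by (auto simp: numeral_led_def)
  ultimately show ?thesis
    using v by (simp only: word_language_append) (intro conc_mono order_refl)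
qed

lemma corner_word_language:
  assumes "perpendicular x y" "v = [] \<or> hd v \<notin> directions \<or> perpendicular y (hd v)"
  obtains t w where "v = t @ w" "t \<in> lists directions" "numeral_led w"
    "lists directions \<cdot> {x # y # t} \<cdot> word_language w \<subseteq> word_language (corner x y # v)"
proof -
  obtain t w where t: "v = t @ w" "t \<in> lists directions" "numeral_led w"
    "t = [] \<or> hd v = hd t \<and> v \<noteq> [] \<and> hd v \<in> directions"
    by (rule direction_split)
  have "x # y # t \<in> phi (corner x y # t)"
    using assms t by (intro corner_phi) auto
  then have "lists directions \<cdot> {x # y # t} \<cdot> word_language w
      \<subseteq> lists directions \<cdot> phi (corner x y # t) \<cdot> word_language w"
    by (intro conc_mono) auto
  also have "\<dots> = word_language ((corner x y # t) @ w)"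
    unfolding word_language_append[OF t(3)]
    by (simp add: t(2) word_language_factor conc_assoc lists_conc_word_language)
  finally show ?thesis
    using that[of t w] t(1-3) by simp
qed

text \<open>Of the image \<open>a b y\<close> of the two letters, \<open>a\<close> goes into the
  preceding \<open>lists directions\<close>, while \<open>b y\<close> spells the new
  numeral.\<close>

lemma word_language_merge_numeral:
  assumes x: "x \<notin> directions" and y: "y \<in> directions"
    and xy: "varphi x y = [a, b, y]"
    and v: "v = [] \<or> hd v \<notin> directions \<or> perpendicular y (hd v)"
  shows "word_language (u @ x # y # v) \<subseteq> word_language (u @ corner b y # v)"
proof -
  have perp: "perpendicular b y" "a \<in> directions"
    using varphi_split[OF x y] xy by auto
  from perp(1) v obtain t w where t: "v = t @ w" "t \<in> lists directions" "numeral_led w"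
    "lists directions \<cdot> {b # y # t} \<cdot> word_language w \<subseteq> word_language (corner b y # v)"
    by (rule corner_word_language)
  have "word_language (x # y # v) = word_language ((x # y # t) @ w)"
    using t by simp
  also have "\<dots> = lists directions \<cdot> {a # b # y # t} \<cdot> word_language w"
    unfolding word_language_append[OF t(3)] using t y xy
    by (subst word_language_factor) (auto simp: conc_assoc lists_conc_word_language)
  also have "{a # b # y # t} = {[a]} \<cdot> {b # y # t}"
    by (simp add: conc_def)
  also have "lists directions \<cdot> ({[a]} \<cdot> {b # y # t}) \<cdot> word_language w
      \<subseteq> (lists directions \<cdot> lists directions) \<cdot> {b # y # t} \<cdot> word_language w"
    unfolding conc_assoc using perp by (intro conc_mono) auto
  also have "\<dots> \<subseteq> word_language (corner b y # v)"
    using t(4) by (simp add: lists_conc_lists)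
  finally show ?thesis
    using x by (simp add: word_language_append numeral_led_def corner_not_direction conc_mono)
qed

text \<open>The factor containing \<open>x y\<close> is cut before \<open>x\<close>: its first part
  remains a factor, and \<open>x y\<close> spells the numeral that heads a new one.\<close>

lemma word_language_merge_direction:
  assumes u: "numeral_led u" "u \<noteq> []" and xy: "perpendicular x y"
    and v: "v = [] \<or> hd v \<notin> directions \<or> perpendicular y (hd v)"
  shows "word_language (u @ x # y # v) \<subseteq> word_language (u @ corner x y # v)"
proof -
  obtain w n d where w: "u = w @ n # d" "n \<notin> directions" "d \<in> lists directions"
    using u by (rule numeral_led_cases)
  from xy v obtain t w' where t: "v = t @ w'" "t \<in> lists directions" "numeral_led w'"
    "lists directions \<cdot> {x # y # t} \<cdot> word_language w' \<subseteq> word_language (corner x y # v)"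
    by (rule corner_word_language)
  have dirs: "x \<in> directions" "y \<in> directions"
    using xy by (auto simp: perpendicular_def directions_def)
  \<comment> \<open>Makes room, via the empty word, for the \<open>lists directions\<close> that
    stands between the two factors after the cut.\<close>
  have e: "{x # y # t} \<subseteq> lists directions \<cdot> {x # y # t}"
    by (auto simp: conc_def)
  have "word_language (n # d @ x # y # v) = word_language ((n # d @ x # y # t) @ w')"
    using t by simp
  also have "\<dots> = lists directions \<cdot> phi (n # d @ x # y # t) \<cdot> word_language w'"
    unfolding word_language_append[OF t(3)] using t dirs w
    by (subst word_language_factor) (auto simp: conc_assoc lists_conc_word_language)
  also have "\<dots> \<subseteq> lists directions \<cdot> (phi (n # d) \<cdot> {x # y # t}) \<cdot> word_language w'"
    using w t dirs by (intro conc_mono phi_append) auto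
  also have "\<dots> \<subseteq> lists directions \<cdot> (phi (n # d) \<cdot> lists directions \<cdot> {x # y # t}) \<cdot> word_language w'"
    by (intro conc_mono e) auto
  also have "\<dots> = word_language (n # d) \<cdot> lists directions \<cdot> {x # y # t} \<cdot> word_language w'"
    by (simp add: word_language_factor[OF w(3)] conc_assoc lists_conc_lists_left)
  also have "\<dots> \<subseteq> word_language (n # d) \<cdot> word_language (corner x y # v)"
    using t(4) by (intro conc_mono) auto
  also have "\<dots> = word_language ((n # d) @ corner x y # v)"
    by (simp add: word_language_append numeral_led_def corner_not_direction del: append.simps)
  finally have "word_language (n # d @ x # y # v) \<subseteq> word_language (n # d @ corner x y # v)"
    by simp
  then show ?thesis
    using w by (simp add: word_language_append numeral_led_def conc_mono)
qed

subsection \<open>Encodings\<close>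

lemma opposite_sides_subset: "opposite_sides c X Y \<Longrightarrow> Y' \<subseteq> Y \<Longrightarrow> opposite_sides c X Y'"
  unfolding opposite_sides_def by blast

lemma separates_mono: "separates p A B \<Longrightarrow> B' \<subseteq> B \<Longrightarrow> B' \<noteq> {} \<Longrightarrow> separates p A B'"
  unfolding separates_def opposite_sides_def by blast

lemma separates_nothing_mono: "separates_nothing p S \<Longrightarrow> T \<subseteq> S \<Longrightarrow> separates_nothing p T"
  unfolding separates_nothing_def by blast

lemma separates_nothing_singleton: "separates_nothing p {q}"
  unfolding separates_nothing_def separates_def opposite_sides_def
  by (fastforce simp: subset_singleton_iff)

lemma bounding_box_mono:
  assumes "finite S" "T \<subseteq> S" "T \<noteq> {}"
  shows "bounding_box T \<subseteq> bounding_box S"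
proof -
  have "Min (f ` S) \<le> Min (f ` T)" "Max (f ` T) \<le> Max (f ` S)" for f :: "point \<Rightarrow> real"
    using assms by (auto intro!: Min_antimono Max_mono)
  then show ?thesis
    unfolding bounding_box_def by (intro Sigma_mono) auto
qed

lemma subset_bounding_box: "finite S \<Longrightarrow> S \<subseteq> bounding_box S"
  by (auto simp: bounding_box_def image_iff intro!: Min_le Max_ge; force)

text \<open>The box extends exactly to the extreme coordinates attained in \<open>S\<close>, so
  positions can be checked on the points alone.\<close>

lemma on_side_bounding_box:
  assumes "finite S" "S \<noteq> {}"
  shows "on_side x p (bounding_box S) \<longleftrightarrow> on_side x p S"
proof
  assume "on_side x p (bounding_box S)"
  then show "on_side x p S"
    using subset_bounding_box[OF assms(1)]
    by (cases x) (auto simp: above_def below_def left_of_def right_of_def)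
next
  have "above p S \<Longrightarrow> Max (snd ` S) < snd p" "below p S \<Longrightarrow> snd p < Min (snd ` S)"
    "right_of p S \<Longrightarrow> Max (fst ` S) < fst p" "left_of p S \<Longrightarrow> fst p < Min (fst ` S)"
    using assms by (simp_all add: above_def below_def left_of_def right_of_def)
  then have "above p S \<Longrightarrow> above p (bounding_box S)" "below p S \<Longrightarrow> below p (bounding_box S)"
    "right_of p S \<Longrightarrow> right_of p (bounding_box S)" "left_of p S \<Longrightarrow> left_of p (bounding_box S)"
    unfolding bounding_box_def above_def below_def left_of_def right_of_def by auto
  moreover assume "on_side x p S"
  ultimately show "on_side x p (bounding_box S)"
    by (cases x) simp_all
qed

lemma on_side_iff_pointwise: "on_side x p S \<longleftrightarrow> (\<forall>q\<in>S. on_side x p {q})"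
  by (cases x) (auto simp: above_def below_def left_of_def right_of_def)

lemma on_side_subset: "on_side x p S \<Longrightarrow> T \<subseteq> S \<Longrightarrow> on_side x p T"
  by (cases x) (auto simp: above_def below_def left_of_def right_of_def)

lemma on_side_numeral_separates_nothing:
  assumes "on_side x p S" "x \<notin> directions"
  shows "separates_nothing p S"
  unfolding separates_nothing_def
proof (intro notI, elim exE conjE)
  fix A B assume AB: "A \<subseteq> S" "B \<subseteq> S" "separates p A B"
  then obtain a b where "a \<in> A" "b \<in> B"
    unfolding separates_def by (meson ex_in_conv)
  then have "on_side x p {a, b}"
    using AB assms(1) by (auto intro: on_side_subset[of x p S])
  moreover have "opposite_sides (fst p) {fst a} {fst b} \<or> opposite_sides (snd p) {snd a} {snd b}"
    using AB(3) \<open>a \<in> A\<close> \<open>b \<in> B\<close> by (auto simp: separates_def opposite_sides_def)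
  ultimately show False
    using assms(2)
    by (cases x) (auto simp: directions_def opposite_sides_def above_def below_def left_of_def right_of_def)
qed

text \<open>For a numeral everything is decided by position: all earlier points lie in one open
  quadrant at \<open>p\<close>, so neither line through \<open>p\<close> separates any of
  them.\<close>

lemma encodes_iff:
  assumes "qs \<noteq> []"
  shows "encodes qs p x \<longleftrightarrow> on_side x p (set qs) \<and>
    (x \<in> directions \<longrightarrow> separates p {last qs} (set (butlast qs)))"
  using assms on_side_numeral_separates_nothing[of x p "set qs"]
  by (auto simp: encodes_def on_side_bounding_box)

lemma on_side_corner:
  "perpendicular x y \<Longrightarrow> on_side (corner x y) p S \<longleftrightarrow> on_side x p S \<and> on_side y p S"
  by (auto simp: perpendicular_def corner_def doubleton_eq_iff)

text \<open>A pin encoded by a direction has a coordinate strictly between those of two earlier points,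
  so the next pin cannot cut it off along that axis.\<close>

lemma directions_alternate:
  assumes "encodes qs p x" "encodes (qs @ [p]) q y" "x \<in> directions" "y \<in> directions" "qs \<noteq> []"
  shows "perpendicular x y \<and> on_side x q (set qs)"
proof -
  have "set (butlast qs) \<noteq> {}"
    using assms(1,3,5) by (simp add: encodes_iff separates_def)
  then obtain r where r: "r \<in> set (butlast qs)"
    by (meson ex_in_conv)
  define l where "l = last qs"
  have mem: "l \<in> set qs" "r \<in> set qs"
    using r assms(5) by (simp_all add: l_def in_set_butlastD)
  have p: "opposite_sides (fst p) {fst l} {fst r} \<or> opposite_sides (snd p) {snd l} {snd r}"
    using separates_mono[of p "{l}" "set (butlast qs)" "{r}"] assms(1,3,5) r
    by (simp add: encodes_iff l_def) (simp add: separates_def)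
  have q: "opposite_sides (fst q) {fst p} (fst ` set qs) \<or>
      opposite_sides (snd q) {snd p} (snd ` set qs)"
    using assms(2,4,5) by (simp add: encodes_iff separates_def)
  have side: "on_side x p (set qs)" "on_side y q (insert p (set qs))"
    using assms(1,2,5) by (simp_all add: encodes_iff)
  \<comment> \<open>With \<open>s\<close> fixed, each pair of letters leaves linear arithmetic on a
    few coordinates. As \<open>q\<close> lies beyond everything along the axis of \<open>y\<close>,
    it separates along the axis of \<open>x\<close>, hence lies between \<open>p\<close> and
    \<open>s\<close> there, on side \<open>x\<close> of \<open>s\<close>.\<close>
  have "perpendicular x y \<and> on_side x q {s}" if "s \<in> set qs" for s
  proof -
    have "on_side x p {l, r, s}" "on_side y q {p, l, r, s}"
      using on_side_subset[OF side(1), of "{l, r, s}"] on_side_subset[OF side(2), of "{p, l, r, s}"]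
        mem that by simp_all
    moreover have "{fst l, fst r, fst s} \<subseteq> fst ` set qs" "{snd l, snd r, snd s} \<subseteq> snd ` set qs"
      using mem that by simp_all
    then have "opposite_sides (fst q) {fst p} {fst l, fst r, fst s} \<or>
        opposite_sides (snd q) {snd p} {snd l, snd r, snd s}"
      using q opposite_sides_subset by metis
    ultimately show ?thesis
      using assms(3,4) p
      by (cases x; cases y; simp add: directions_def perpendicular_def opposite_sides_def
          above_def below_def left_of_def right_of_def; (elim disjE conjE; linarith))
  qed
  then show ?thesis
    using mem(1) on_side_iff_pointwise[of x q "set qs"] by auto
qed

text \<open>Being extreme along the axis of \<open>y\<close>, \<open>q\<close> must separate
  \<open>p\<close> from \<open>qs\<close> along the other axis. There it lies between them, on the
  side of \<open>qs\<close> named by the component \<open>b\<close> of \<open>x\<close>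
  perpendicular to \<open>y\<close>.\<close>

lemma numeral_direction_side:
  assumes "encodes qs p x" "encodes (qs @ [p]) q y" "x \<notin> directions" "y \<in> directions" "qs \<noteq> []"
    and "varphi x y = [a, b, y]"
  shows "on_side b q (set qs)"
proof -
  have q: "opposite_sides (fst q) {fst p} (fst ` set qs) \<or>
      opposite_sides (snd q) {snd p} (snd ` set qs)"
    using assms(2,4,5) by (simp add: encodes_iff separates_def)
  have side: "on_side x p (set qs)" "on_side y q (insert p (set qs))"
    using assms(1,2,5) by (simp_all add: encodes_iff)
  have "on_side b q {s}" if "s \<in> set qs" for s
  proof -
    have "on_side x p {s}" "on_side y q {p, s}"
      using on_side_subset[OF side(1), of "{s}"] on_side_subset[OF side(2), of "{p, s}"] that
      by simp_all
    moreover have "{fst s} \<subseteq> fst ` set qs" "{snd s} \<subseteq> snd ` set qs"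
      using that by simp_all
    then have "opposite_sides (fst q) {fst p} {fst s} \<or> opposite_sides (snd q) {snd p} {snd s}"
      using q opposite_sides_subset by metis
    ultimately show ?thesis
      using assms(3,4,6)
      by (cases x; cases y) (auto simp: directions_def opposite_sides_def
          above_def below_def left_of_def right_of_def)
  qed
  then show ?thesis
    using on_side_iff_pointwise[of b q "set qs"] by auto
qed

section \<open>Encodings of whole point sequences and deletion of points\<close>

fun pin_encoding :: "point list \<Rightarrow> point list \<Rightarrow> letter list \<Rightarrow> bool" where
  "pin_encoding qs [] [] \<longleftrightarrow> True"
| "pin_encoding qs (p # ps) (x # u) \<longleftrightarrow> encodes qs p x \<and> pin_encoding (qs @ [p]) ps u"
| "pin_encoding qs _ _ \<longleftrightarrow> False"

lemma pin_encoding_iff_nth: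
  "pin_encoding qs ps u \<longleftrightarrow> length u = length ps \<and>
     (\<forall>i<length ps. encodes (qs @ take i ps) (ps ! i) (u ! i))"
proof (induction qs ps u rule: pin_encoding.induct)
  case (2 qs p ps x u)
  then show ?case
    by (simp add: All_less_Suc2) blast
qed auto

lemma pin_encoding_append:
  "length ps = length u \<Longrightarrow>
   pin_encoding qs (ps @ ps') (u @ v) \<longleftrightarrow> pin_encoding qs ps u \<and> pin_encoding (qs @ ps) ps' v"
  by (induction qs ps u rule: pin_encoding.induct) auto

text \<open>Before the first pin there is only the origin, so a direction would have to separate it
  from the empty set.\<close>

lemma pin_encoding_numeral_led: "pin_encoding [p0] ps u \<Longrightarrow> numeral_led u"
  by (cases ps; cases u) (auto simp: numeral_led_def encodes_def separates_def)

text \<open>Sides and separation survive the loss of earlier points as long as the set cut off from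
  the last point stays nonempty. Only the first letter needs care: afterwards the last point is the
  newly added pin, preceded by the nonempty \<open>qs'\<close>.\<close>

lemma pin_encoding_earlier_subset:
  assumes "pin_encoding qs ps u" "set qs' \<subseteq> set qs" "qs' \<noteq> []"
    and "u \<noteq> [] \<Longrightarrow> hd u \<in> directions \<Longrightarrow>
      last qs' = last qs \<and> butlast qs' \<noteq> [] \<and> set (butlast qs') \<subseteq> set (butlast qs)"
  shows "pin_encoding qs' ps u"
  using assms
proof (induction qs ps u arbitrary: qs' rule: pin_encoding.induct)
  case (2 qs p ps x u)
  have "qs \<noteq> []"
    using 2(3,4) by auto
  then have "on_side x p (set qs)" "x \<in> directions \<Longrightarrow> separates p {last qs} (set (butlast qs))"
    using 2(2) by (auto simp: encodes_iff)
  then have "encodes qs' p x"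
    using 2(3-) on_side_subset[of x p "set qs" "set qs'"]
      separates_mono[of p "{last qs}" "set (butlast qs)" "set (butlast qs')"]
    by (simp add: encodes_iff)
  moreover have "pin_encoding (qs' @ [p]) ps u"
  proof (rule 2(1))
    show "pin_encoding (qs @ [p]) ps u"
      using 2(2) by simp
  qed (use 2(3,4) in auto)
  ultimately show ?case
    by simp
qed simp_all

text \<open>Only the letter right after \<open>p\<close> can name \<open>p\<close> as the point
  being cut off; for later pins \<open>p\<close> is merely one of the earlier points.\<close>

lemma pin_encoding_delete_point:
  assumes enc: "pin_encoding [p0] (ps @ p # rs) w"
  shows "\<exists>w'. pin_encoding [p0] (ps @ rs) w' \<and> word_language w \<subseteq> word_language w'"
proof -
  have "length w = length (ps @ p # rs)"
    using enc by (simp add: pin_encoding_iff_nth)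
  then obtain u x v where w: "w = u @ x # v" "length u = length ps"
    by (metis add_diff_cancel_left' append_take_drop_id id_take_nth_drop length_append
        length_Cons length_take less_add_Suc1 min.absorb4 add_Suc_right)
  let ?qs = "p0 # ps"
  have u: "pin_encoding [p0] ps u" and x: "encodes ?qs p x" and v: "pin_encoding (?qs @ [p]) rs v"
    using enc w by (simp_all add: pin_encoding_append)
  have "numeral_led u" "numeral_led (u @ [x])"
    using u pin_encoding_numeral_led[OF enc] w(1)
    by (auto simp: pin_encoding_numeral_led numeral_led_def hd_append split: if_splits)
  show ?thesis
  proof (cases "numeral_led v")
    case True
    then have "pin_encoding ?qs rs v"
      using pin_encoding_earlier_subset[OF v, of ?qs] by (auto simp: numeral_led_def)
    with u w have "pin_encoding [p0] (ps @ rs) (u @ v)"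
      by (simp add: pin_encoding_append)
    then show ?thesis
      using word_language_drop_letter[OF \<open>numeral_led u\<close> True \<open>numeral_led (u @ [x])\<close>] w by blast
  next
    case False
    then obtain y v' where y: "v = y # v'" "y \<in> directions"
      by (cases v) (auto simp: numeral_led_def)
    with v obtain q rs' where rs: "rs = q # rs'"
      by (cases rs) auto
    have q: "encodes (?qs @ [p]) q y" and v': "pin_encoding (?qs @ [p] @ [q]) rs' v'"
      using v y rs by auto
    \<comment> \<open>Consecutive directions alternate between the axes; this is what the merge
      lemmas require of the letter after \<open>y\<close>.\<close>
    have "v' = [] \<or> hd v' \<notin> directions \<or> perpendicular y (hd v')"
    proof (cases v')
      case (Cons z v'')
      with v' obtain r rs'' where "encodes ((?qs @ [p]) @ [q]) r z"
        by (cases rs') auto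
      from directions_alternate[OF q this y(2)] Cons show ?thesis
        by auto
    qed simp
    note merge = this
    \<comment> \<open>\<open>b\<close> is the second direction describing \<open>q\<close> once
      \<open>p\<close> is gone: \<open>x\<close> itself if it is a direction, otherwise the
      component of the numeral \<open>x\<close> perpendicular to \<open>y\<close>.\<close>
    obtain b where b: "perpendicular b y" "on_side b q (set ?qs)"
      "word_language w \<subseteq> word_language (u @ corner b y # v')"
    proof (cases "x \<in> directions")
      case True
      then have "u \<noteq> []"
        using \<open>numeral_led (u @ [x])\<close> by (auto simp: numeral_led_def)
      with that[of x] directions_alternate[OF x q True y(2)] \<open>numeral_led u\<close> merge show ?thesis
        using word_language_merge_direction[of u x y v'] w y by auto
    next
      case False
      then obtain a b where ab: "varphi x y = [a, b, y]" "perpendicular b y"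
        using varphi_split y by metis
      then show ?thesis
        using that[of b] numeral_direction_side[OF x q False y(2) _ ab(1)]
          word_language_merge_numeral[OF False y(2) ab(1) merge] w y by auto
    qed
    have "on_side y q (set ?qs)"
      using q on_side_subset[of y q "set (?qs @ [p])" "set ?qs"] by (auto simp: encodes_iff)
    with b have "encodes ?qs q (corner b y)"
      by (simp add: encodes_iff on_side_corner corner_not_direction)
    moreover have "pin_encoding (?qs @ [q]) rs' v'"
      using pin_encoding_earlier_subset[OF v', of "?qs @ [q]"] by (auto simp: butlast_append)
    ultimately have "pin_encoding [p0] (ps @ rs) (u @ corner b y # v')"
      using u rs w by (simp add: pin_encoding_append)
    with b(3) show ?thesis
      by blast
  qed
qed

text \<open>The prefix \<open>ps\<close> accumulates the points already kept, so the induction can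
  delete in the middle of the sequence.\<close>

lemma pin_encoding_filter:
  assumes "pin_encoding [p0] (ps @ rs) u"
  shows "\<exists>v. pin_encoding [p0] (ps @ filter P rs) v \<and> word_language u \<subseteq> word_language v"
  using assms
proof (induction rs arbitrary: ps u)
  case (Cons r rs)
  show ?case
  proof (cases "P r")
    case True
    then show ?thesis
      using Cons.IH[of "ps @ [r]" u] Cons.prems by simp
  next
    case False
    obtain w where "pin_encoding [p0] (ps @ rs) w" "word_language u \<subseteq> word_language w"
      using pin_encoding_delete_point[OF Cons.prems] by blast
    then show ?thesis
      using Cons.IH[of ps w] False by auto
  qed
qed auto

subsection \<open>Pin sequences and patterns\<close>

lemma encodes_outside_bounding_box: "encodes qs p x \<Longrightarrow> p \<notin> bounding_box (set qs)"
  by (cases x; cases p) (auto simp: encodes_def above_def below_def left_of_def right_of_def)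

lemma pin_sequence_iff:
  "pin_sequence ps \<longleftrightarrow> distinct (map fst ps) \<and> distinct (map snd ps) \<and>
     (\<forall>i. 1 \<le> i \<and> i < length ps \<longrightarrow>
        ps ! i \<notin> bounding_box (set (take i ps)) \<and>
        (separates (ps ! i) {ps ! (i - 1)} (set (take (i - 1) ps)) \<or>
         separates_nothing (ps ! i) (set (take i ps))))"
proof -
  have "distinct (map f ps) \<longleftrightarrow>
      (\<forall>i<length ps. \<forall>j<length ps. i \<noteq> j \<longrightarrow> f (ps ! i) \<noteq> f (ps ! j))" for f :: "point \<Rightarrow> real"
    by (simp add: distinct_conv_nth)
  then have *: "distinct (map fst ps) \<and> distinct (map snd ps) \<longleftrightarrow>
      (\<forall>i<length ps. \<forall>j<length ps. i \<noteq> j \<longrightarrow>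
        fst (ps ! i) \<noteq> fst (ps ! j) \<and> snd (ps ! i) \<noteq> snd (ps ! j))"
    by blast
  show ?thesis
    unfolding pin_sequence_def *[symmetric] by (simp only: conj_assoc)
qed

text \<open>The letters certify the pin conditions: a direction provides the separation, a numeral
  provides \<open>separates_nothing\<close>.\<close>

lemma pin_encoding_pin_sequence:
  assumes "pin_encoding [p0] ps u" "distinct (map fst (p0 # ps))" "distinct (map snd (p0 # ps))"
  shows "pin_sequence (p0 # ps)"
  unfolding pin_sequence_iff
proof (intro conjI allI impI assms)
  let ?ps = "p0 # ps"
  fix i assume i: "1 \<le> i \<and> i < length ?ps"
  then obtain k where k: "i = Suc k" "k < length ps"
    by (cases i) auto
  then have enc: "encodes (take i ?ps) (?ps ! i) (u ! k)"
    using assms(1) by (simp add: pin_encoding_iff_nth)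
  then show "?ps ! i \<notin> bounding_box (set (take i ?ps))"
    by (rule encodes_outside_bounding_box)
  have "last (take i ?ps) = ?ps ! (i - 1)" "butlast (take i ?ps) = take (i - 1) ?ps"
    using i by (auto simp: last_conv_nth butlast_take simp del: take_Suc_Cons)
  then show "separates (?ps ! i) {?ps ! (i - 1)} (set (take (i - 1) ?ps)) \<or>
      separates_nothing (?ps ! i) (set (take i ?ps))"
    using enc by (auto simp: encodes_def split: if_splits)
qed

text \<open>The conditions pass to fewer points, except that the second pin of \<open>ps\<close> may
  have separated the first one from the origin alone. One remaining point cannot be separated, so
  the other alternative holds there.\<close>

lemma pin_sequence_tl:
  assumes "pin_sequence (p0 # ps)"
  shows "pin_sequence ps"
  unfolding pin_sequence_iff
proof (intro conjI allI impI)
  show "distinct (map fst ps)" "distinct (map snd ps)"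
    using assms by (simp_all add: pin_sequence_iff)
next
  fix i assume i: "1 \<le> i \<and> i < length ps"
  have *: "ps ! i \<notin> bounding_box (set (p0 # take i ps))"
    "separates (ps ! i) {ps ! (i - 1)} (set (p0 # take (i - 1) ps)) \<or>
     separates_nothing (ps ! i) (set (p0 # take i ps))"
    using assms[unfolded pin_sequence_iff, THEN conjunct2, THEN conjunct2, rule_format, of "Suc i"] i
    by (cases i; simp)+
  have ne: "set (take i ps) \<noteq> {}"
    using i by auto
  have "bounding_box (set (take i ps)) \<subseteq> bounding_box (set (p0 # take i ps))"
    using ne by (intro bounding_box_mono) auto
  with *(1) show "ps ! i \<notin> bounding_box (set (take i ps))"
    by blast
  show "separates (ps ! i) {ps ! (i - 1)} (set (take (i - 1) ps)) \<or>
      separates_nothing (ps ! i) (set (take i ps))"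
  proof (cases "i = 1")
    case True
    then have "set (take i ps) = {ps ! 0}"
      using i by (cases ps) auto
    then show ?thesis
      by (simp add: separates_nothing_singleton)
  next
    case False
    then have "set (take (i - 1) ps) \<noteq> {}"
      using i by auto
    with *(2) show ?thesis
        using separates_mono[OF _ set_subset_Cons] separates_nothing_mono[OF _ set_subset_Cons] by blast
  qed
qed

section \<open>Patterns as subsets of a point set\<close>

lemma subseq_index_embedding:
  "subseq xs ys \<Longrightarrow> \<exists>h::nat \<Rightarrow> nat. strict_mono h \<and>
     (\<forall>i<length xs. h i < length ys \<and> xs ! i = ys ! h i)"
proof (induction rule: list_emb.induct)
  case (list_emb_Nil ys)
  show ?case
    by (rule exI[of _ id]) (simp add: strict_mono_def)
next
  case (list_emb_Cons xs ys y)
  then obtain h :: "nat \<Rightarrow> nat" where "strict_mono h" "\<forall>i<length xs. h i < length ys \<and> xs ! i = ys ! h i"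
    by blast
  then show ?case
    by (intro exI[of _ "Suc \<circ> h"]) (simp add: strict_mono_def)
next
  case (list_emb_Cons2 x y xs ys)
  then obtain h :: "nat \<Rightarrow> nat" where "strict_mono h" "\<forall>i<length xs. h i < length ys \<and> xs ! i = ys ! h i"
    by blast
  then show ?case
    using list_emb_Cons2(1)
    \<comment> \<open>The matched heads correspond at index 0; all later indices shift by one on
      both sides.\<close>
    by (intro exI[of _ "case_nat 0 (Suc \<circ> h)"])
       (auto simp: strict_mono_def nth_Cons split: nat.split)
qed

text \<open>Equality of points is determined by the two strict orders, so sending \<open>a i\<close>
  to \<open>b i\<close> is well defined and injective even if the families repeat points.\<close>

lemma order_isomorphic_points_images:
  assumes "\<And>i j. i \<in> I \<Longrightarrow> j \<in> I \<Longrightarrow> fst (a i) < fst (a j) \<longleftrightarrow> fst (b i) < fst (b j)"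
    and "\<And>i j. i \<in> I \<Longrightarrow> j \<in> I \<Longrightarrow> snd (a i) < snd (a j) \<longleftrightarrow> snd (b i) < snd (b j)"
  shows "order_isomorphic_points (a ` I) (b ` I)"
proof -
  have eq: "a i = a j \<longleftrightarrow> b i = b j" if "i \<in> I" "j \<in> I" for i j
    using assms[OF that] assms[OF that(2,1)] unfolding prod_eq_iff
    by (metis linorder_cases order_less_irrefl)
  define f where "f = b \<circ> inv_into I a"
  have f: "f (a i) = b i" if "i \<in> I" for i
    using eq[of "inv_into I a (a i)" i] that by (simp add: f_def inv_into_into f_inv_into_f)
  have "bij_betw f (a ` I) (b ` I)"
    unfolding bij_betw_def inj_on_def using eq f by (force simp: image_image)
  then show ?thesis
    unfolding order_isomorphic_points_def using assms f by (intro exI[of _ f]) auto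
qed

lemma order_isomorphic_points_pattern:
  assumes "order_isomorphic_points S (diagram \<sigma>)" "pattern_of \<pi> \<sigma>"
  obtains T where "T \<subseteq> S" "order_isomorphic_points T (diagram \<pi>)"
proof -
  obtain f where f: "bij_betw f S (diagram \<sigma>)"
    "\<And>p q. p \<in> S \<Longrightarrow> q \<in> S \<Longrightarrow> fst p < fst q \<longleftrightarrow> fst (f p) < fst (f q)"
    "\<And>p q. p \<in> S \<Longrightarrow> q \<in> S \<Longrightarrow> snd p < snd q \<longleftrightarrow> snd (f p) < snd (f q)"
    using assms(1) unfolding order_isomorphic_points_def by blast
  obtain \<tau> where \<tau>: "subseq \<tau> \<sigma>" "order_isomorphic \<tau> \<pi>"
    using assms(2) unfolding pattern_of_def by blast
  obtain h :: "nat \<Rightarrow> nat" where h: "strict_mono h"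
    "\<And>i. i < length \<tau> \<Longrightarrow> h i < length \<sigma> \<and> \<tau> ! i = \<sigma> ! h i"
    using subseq_index_embedding[OF \<tau>(1)] by blast
  \<comment> \<open>The point of \<open>S\<close> that represents the entry of
    \<open>\<sigma>\<close> playing the role of the \<open>i\<close>-th entry of
    \<open>\<pi>\<close>.\<close>
  define a where "a i = inv_into S f (real (Suc (h i)), real (\<sigma> ! h i))" for i
  have "(real (Suc (h i)), real (\<sigma> ! h i)) \<in> f ` S" if "i < length \<pi>" for i
    using that f(1) h(2)[of i] \<tau>(2) unfolding bij_betw_def diagram_def order_isomorphic_def by auto
  then have a: "a i \<in> S" "f (a i) = (real (Suc (h i)), real (\<sigma> ! h i))" if "i < length \<pi>" for i
    using that unfolding a_def by (auto intro: inv_into_into f_inv_into_f)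
  have "order_isomorphic_points (a ` {..<length \<pi>})
      ((\<lambda>i. (real (Suc i), real (\<pi> ! i))) ` {..<length \<pi>})"
    using h \<tau>(2) by (intro order_isomorphic_points_images)
      (auto simp: f(2,3) a strict_mono_less order_isomorphic_def)
  moreover have "(\<lambda>i. (real (Suc i), real (\<pi> ! i))) ` {..<length \<pi>} = diagram \<pi>"
    by (auto simp: diagram_def)
  ultimately show ?thesis
    using that[of "a ` {..<length \<pi>}"] a by auto
qed

lemma pin_words_iff:
  "u \<in> pin_words \<pi> \<longleftrightarrow> (\<exists>p0 ps. pin_encoding [p0] ps u \<and> pin_sequence (p0 # ps) \<and>
     order_isomorphic_points (set ps) (diagram \<pi>))"
  unfolding pin_words_def pin_representation_def pin_encoding_iff_nth
  by (auto intro: pin_sequence_tl)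

lemma pin_words_pattern:
  assumes "pattern_of \<pi> \<sigma>" "u \<in> pin_words \<sigma>"
  shows "\<exists>v \<in> pin_words \<pi>. word_language u \<subseteq> word_language v"
proof -
  obtain p0 ps where ps: "pin_encoding [p0] ps u" "pin_sequence (p0 # ps)"
    "order_isomorphic_points (set ps) (diagram \<sigma>)"
    using assms(2) unfolding pin_words_iff by blast
  obtain T where T: "T \<subseteq> set ps" "order_isomorphic_points T (diagram \<pi>)"
    using ps(3) assms(1) by (rule order_isomorphic_points_pattern)
  define qs where "qs = filter (\<lambda>p. p \<in> T) ps"
  obtain v where v: "pin_encoding [p0] qs v" "word_language u \<subseteq> word_language v"
    using pin_encoding_filter[of p0 "[]" ps u] ps(1) by (auto simp: qs_def)
  \<comment> \<open>The old origin serves again: general position is inherited by the filtered list,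
    and the encoding \<open>v\<close> supplies the remaining pin conditions.\<close>
  have "distinct (map fst (p0 # qs))" "distinct (map snd (p0 # qs))"
    using ps(2) by (auto simp: pin_sequence_iff qs_def distinct_map_filter)
  then have "pin_sequence (p0 # qs)"
    by (rule pin_encoding_pin_sequence[OF v(1)])
  moreover have "set qs = T"
    using T(1) by (auto simp: qs_def)
  ultimately show ?thesis
    using v T(2) unfolding Bex_def pin_words_iff by metis
qed

theorem theorem3p15:
  fixes \<pi> \<sigma> :: "nat list" and k n :: nat
  assumes "\<pi> \<in> permutations_of_set {1..k}"
    and "\<sigma> \<in> permutations_of_set {1..n}"
    and "pattern_of \<pi> \<sigma>"
  shows "perm_language \<sigma> \<subseteq> perm_language \<pi>"
  unfolding perm_language_def using pin_words_pattern[OF assms(3)] by blast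

end
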